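(* Let $\hbar,\hbar'>0$, let $\lambda_0,\lambda_1,\mu_1,\varepsilon,\varepsilon'\in\mathbb{R}$ with $\lambda_0\ne0$ and $r,r'\in\mathbb{Z}$ satisfy $$\lambda_0\varepsilon+\lambda_1r=-\hbar,\quad \lambda_0\varepsilon'+\mu_1r'=\hbar',\quad\lambda_0\varepsilon'+\lambda_1r'=0,\quad\lambda_0\varepsilon+\mu_1r=0$$ (so that $\mathcal{S}(\mathbb{R}\times\mathbb{Z})$ becomes a $(\mathcal{C}_\hbar^\infty,\mathcal{C}_{\hbar'}^\infty)$-bimodule with parameters $\lambda_0,\lambda_1,\varepsilon,r$ and $\lambda_0,\mu_1,\varepsilon',r'$ respectively, as described in the context), and assume that $\beta,\gamma\in\mathbb{C}$ are such that $$\beta\varepsilon+\gamma r=\beta\varepsilon'+\gamma r'=2\pi i.$$ (1) If $\hbar=\hbar'$ then $\beta=0$, $r=r'\ne0$, $\varepsilon\ne\varepsilon'$ and $$\lambda_0=\frac{\hbar}{\varepsilon'-\varepsilon},\quad\lambda_1=-\frac{\hbar\varepsilon'}{r(\varepsilon'-\varepsilon)},\quad\mu_1=-\frac{\hbar\varepsilon}{r(\varepsilon'-\varepsilon)},\quad\gamma=\frac{2\pi i}{r}.$$ (2) If $\hbar\neq\hbar'$ then $\hbar/\hbar'=r/r'\in\mathbb{Q}$ and $$\mu_1=\frac{\hbar'-\hbar}{r'-r}+\lambda_1,\quad\varepsilon=-\frac{1}{\lambda_0}(\hbar+\lambda_1r),\quad\varepsilon'=-\frac{\lambda_1r'}{\lambda_0},$$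 $$\beta=2\pi i\lambda_0\frac{\hbar-\hbar'}{\hbar\hbar'},\quad\gamma=\frac{2\pi i}{r'}+2\pi i\lambda_1\frac{\hbar-\hbar'}{\hbar\hbar'}.$$
   Context: For $\hbar\in\mathbb{R}$, $\mathcal{C}_\hbar^\infty$ is the space $\mathcal{S}(\mathbb{R}\times S^1)$ of Schwartz functions $f=\sum_nf_n(u)W^n$, $W=e^{2\pi it}$, with product $fg=\sum_{n}\big[\sum_{k}f_k(u)g_{n-k}(u+k\hbar)\big]W^n$. The bimodule with left parameters $(\lambda_0,\lambda_1,\varepsilon,r)$ and right parameters $(\mu_0,\mu_1,\varepsilon',r')$, here with $\mu_0=\lambda_0$, is $\mathcal{S}(\mathbb{R}\times\mathbb{Z})$ with $(f\xi)(x,k)=\sum_nf_n(\lambda_0x+\lambda_1k)\xi(x-n\varepsilon,k-nr)$ and $(\xi f)(x,k)=\sum_nf_n(\mu_0x+\mu_1k-n\hbar')\xi(x-n\varepsilon',k-nr')$; the requirements for a bimodule are $\lambda_0\varepsilon+\lambda_1r=-\hbar$, $\mu_0\varepsilon'+\mu_1r'=\hbar'$, $\lambda_0\varepsilon'+\lambda_1r'=0$, $\mu_0\varepsilon+\mu_1r=0$. *)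

theory Defs
  imports Complex_Main
begin

end

(* The four parameter relations give (mu1 - lam1) r = h and (mu1 - lam1) r' = h', so r and r' are
   nonzero and h / h' = r / r'. Scaling the two equations for \<beta> and \<gamma> by lam0 and eliminating
   \<epsilon> and \<epsilon>' leaves a linear system for \<beta> and lam0 \<gamma> with coefficients mu1 r, lam1 r', r, r'. *)
theory Submission imports Defs
begin

theorem proposition4p14:
  fixes h h' lam\<^sub>0 lam\<^sub>1 mu\<^sub>1 \<epsilon> \<epsilon>' :: real
    and r r' :: int
    and \<beta> \<gamma> :: complex
  assumes "h > 0" and "h' > 0"
    and "lam\<^sub>0 \<noteq> 0"
    and "lam\<^sub>0 * \<epsilon> + lam\<^sub>1 * of_int r = - h"
    and "lam\<^sub>0 * \<epsilon>' + mu\<^sub>1 * of_int r' = h'"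
    and "lam\<^sub>0 * \<epsilon>' + lam\<^sub>1 * of_int r' = 0"
    and "lam\<^sub>0 * \<epsilon> + mu\<^sub>1 * of_int r = 0"
    and "\<beta> * of_real \<epsilon> + \<gamma> * of_int r = 2 * of_real pi * \<i>"
    and "\<beta> * of_real \<epsilon>' + \<gamma> * of_int r' = 2 * of_real pi * \<i>"
  shows
    "(h = h' \<longrightarrow>
        \<beta> = 0 \<and> r = r' \<and> r' \<noteq> 0 \<and> \<epsilon> \<noteq> \<epsilon>' \<and>
        lam\<^sub>0 = h / (\<epsilon>' - \<epsilon>) \<and>
        lam\<^sub>1 = - (h * \<epsilon>' / (of_int r * (\<epsilon>' - \<epsilon>))) \<and>
        mu\<^sub>1 = - (h * \<epsilon> / (of_int r * (\<epsilon>' - \<epsilon>))) \<and>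
        \<gamma> = 2 * of_real pi * \<i> / of_int r) \<and>
     (h \<noteq> h' \<longrightarrow>
        h / h' = of_int r / of_int r' \<and> h / h' \<in> \<rat> \<and>
        mu\<^sub>1 = (h' - h) / of_int (r' - r) + lam\<^sub>1 \<and>
        \<epsilon> = - (1 / lam\<^sub>0) * (h + lam\<^sub>1 * of_int r) \<and>
        \<epsilon>' = - (lam\<^sub>1 * of_int r' / lam\<^sub>0) \<and>
        \<beta> = 2 * of_real pi * \<i> * of_real lam\<^sub>0 * of_real ((h - h') / (h * h')) \<and>
        \<gamma> = 2 * of_real pi * \<i> / of_int r'
            + 2 * of_real pi * \<i> * of_real lam\<^sub>1 * of_real ((h - h') / (h * h')))"
proof -
  \<comment> \<open>\<open>d\<close> is the common factor of both deformation parameters: the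
    relations containing \<open>\<epsilon>\<close> differ by \<open>d * r = h\<close>, those
    containing \<open>\<epsilon>'\<close> by \<open>d * r' = h'\<close>.\<close>
  define d where "d = mu\<^sub>1 - lam\<^sub>1"
  define P where "P = 2 * of_real pi * \<i>"
  have dr: "d * of_int r = h" and dr': "d * of_int r' = h'"
    using assms(4-7) by (simp_all add: d_def algebra_simps)
  have d0: "d \<noteq> 0" and r0: "r \<noteq> 0" and r'0: "r' \<noteq> 0"
    using dr dr' assms(1,2) by auto
  \<comment> \<open>Of the two relations for \<open>\<epsilon>\<close>, the homogeneous one is used,
    so that \<open>h\<close> does not enter and the factor \<open>r\<close> can be divided
    out.\<close>
  have gamma_mu: "\<gamma> * of_real lam\<^sub>0 = P * of_real lam\<^sub>0 / of_int r + \<beta> * of_real mu\<^sub>1"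
  proof -
    have "lam\<^sub>0 * \<epsilon> = - mu\<^sub>1 * of_int r" using assms(7) by simp
    hence "of_real lam\<^sub>0 * of_real \<epsilon> = - of_real mu\<^sub>1 * (of_int r :: complex)"
      by (metis of_real_mult of_real_minus of_real_of_int_eq)
    moreover have "of_real lam\<^sub>0 * (\<beta> * of_real \<epsilon> + \<gamma> * of_int r) = of_real lam\<^sub>0 * P"
      using assms(8) by (simp add: P_def)
    ultimately have "\<gamma> * of_real lam\<^sub>0 * of_int r = P * of_real lam\<^sub>0 + \<beta> * of_real mu\<^sub>1 * of_int r"
      by algebra
    thus ?thesis using r0 by (simp add: field_simps)
  qed
  \<comment> \<open>The same elimination for \<open>\<epsilon>'\<close>, whose homogeneous relation
    contains \<open>lam\<^sub>1\<close> in place of \<open>mu\<^sub>1\<close>.\<close>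
  have gamma_lam: "\<gamma> * of_real lam\<^sub>0 = P * of_real lam\<^sub>0 / of_int r' + \<beta> * of_real lam\<^sub>1"
  proof -
    have "lam\<^sub>0 * \<epsilon>' = - lam\<^sub>1 * of_int r'" using assms(6) by simp
    hence "of_real lam\<^sub>0 * of_real \<epsilon>' = - of_real lam\<^sub>1 * (of_int r' :: complex)"
      by (metis of_real_mult of_real_minus of_real_of_int_eq)
    moreover have "of_real lam\<^sub>0 * (\<beta> * of_real \<epsilon>' + \<gamma> * of_int r') = of_real lam\<^sub>0 * P"
      using assms(9) by (simp add: P_def)
    ultimately have "\<gamma> * of_real lam\<^sub>0 * of_int r' = P * of_real lam\<^sub>0 + \<beta> * of_real lam\<^sub>1 * of_int r'"
      by algebra
    thus ?thesis using r'0 by (simp add: field_simps)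
  qed
  \<comment> \<open>Substituting \<open>h = d * r\<close> and \<open>h' = d * r'\<close> turns the
    right side into \<open>(r - r') / (r * r')\<close>.\<close>
  have inv: "1 / of_int r' - 1 / of_int r = d * ((h - h') / (h * h'))"
    using d0 r0 r'0 by (simp add: dr[symmetric] dr'[symmetric] field_simps)
  have beta: "\<beta> = P * of_real lam\<^sub>0 * of_real ((h - h') / (h * h'))"
  proof -
    \<comment> \<open>Equating the two expressions for \<open>\<gamma> * lam\<^sub>0\<close> leaves
      \<open>\<beta>\<close> with coefficient \<open>mu\<^sub>1 - lam\<^sub>1 = d\<close>.\<close>
    have "of_real d * \<beta> = P * of_real lam\<^sub>0 * (1 / of_int r' - 1 / of_int r)"
      using gamma_mu gamma_lam by (simp add: d_def algebra_simps)
    \<comment> \<open>The identity \<open>inv\<close> holds over the reals, so the complex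
      difference is first recognised as the image of a real one.\<close>
    also have "1 / of_int r' - 1 / of_int r = (of_real (1 / of_int r' - 1 / of_int r) :: complex)"
      by simp
    also have "\<dots> = of_real d * of_real ((h - h') / (h * h'))"
      unfolding inv by (rule of_real_mult)
    finally have "of_real d * \<beta> = of_real d * (P * of_real lam\<^sub>0 * of_real ((h - h') / (h * h')))"
      by (simp only: mult_ac)
    thus ?thesis using d0 by (simp only: mult_cancel_left of_real_eq_0_iff) simp
  qed
  have gamma: "\<gamma> = P / of_int r' + P * of_real lam\<^sub>1 * of_real ((h - h') / (h * h'))"
  proof -
    \<comment> \<open>Once \<open>\<beta>\<close> is inserted, every term of
      \<open>gamma_lam\<close> contains \<open>lam\<^sub>0\<close>, which then cancels.\<close>
    have "of_real lam\<^sub>0 * \<gamma>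
        = of_real lam\<^sub>0 * (P / of_int r' + P * of_real lam\<^sub>1 * of_real ((h - h') / (h * h')))"
      using gamma_lam unfolding beta by (simp only: algebra_simps times_divide_eq_right)
    thus ?thesis using assms(3) by (simp only: mult_cancel_left of_real_eq_0_iff) simp
  qed
  show ?thesis
  proof (intro conjI[of "_ \<longrightarrow> _"] impI)
    assume hh: "h = h'"
    have rr: "r = r'" using dr dr' d0 hh by (metis mult_left_cancel of_int_eq_iff)
    \<comment> \<open>With \<open>r = r'\<close> the \<open>lam\<^sub>1\<close> terms cancel on
      subtracting the relations; since \<open>h > 0\<close>, this also separates
      \<open>\<epsilon>\<close> from \<open>\<epsilon>'\<close>.\<close>
    have lam0: "lam\<^sub>0 * (\<epsilon>' - \<epsilon>) = h" using assms(4,6) rr by (simp add: algebra_simps)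
    have ne: "\<epsilon>' - \<epsilon> \<noteq> 0" using lam0 assms(1) by auto
    have "lam\<^sub>0 = h / (\<epsilon>' - \<epsilon>)" using lam0 ne by (simp add: field_simps)
    \<comment> \<open>The homogeneous relations are solved with \<open>lam\<^sub>0\<close> kept;
      inserting its value gives the stated quotients.\<close>
    moreover have "lam\<^sub>1 = - (lam\<^sub>0 * \<epsilon>' / of_int r)" "mu\<^sub>1 = - (lam\<^sub>0 * \<epsilon> / of_int r)"
      using assms(6,7) r0 rr by (simp_all add: field_simps)
    ultimately show "\<beta> = 0 \<and> r = r' \<and> r' \<noteq> 0 \<and> \<epsilon> \<noteq> \<epsilon>' \<and>
        lam\<^sub>0 = h / (\<epsilon>' - \<epsilon>) \<and>
        lam\<^sub>1 = - (h * \<epsilon>' / (of_int r * (\<epsilon>' - \<epsilon>))) \<and>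
        mu\<^sub>1 = - (h * \<epsilon> / (of_int r * (\<epsilon>' - \<epsilon>))) \<and>
        \<gamma> = 2 * of_real pi * \<i> / of_int r"
      \<comment> \<open>The factor \<open>h - h'\<close> vanishes, which kills
        \<open>\<beta>\<close> and the second summand of \<open>\<gamma>\<close>.\<close>
      using beta gamma hh rr r'0 ne by (simp add: P_def mult.commute)
  next
    assume hh: "h \<noteq> h'"
    have ratio: "h / h' = of_int r / of_int r'"
      using d0 by (simp add: dr[symmetric] dr'[symmetric])
    \<comment> \<open>If \<open>r = r'\<close>, then \<open>h = d * r = d * r' = h'\<close>.\<close>
    have "of_int (r' - r) \<noteq> (0::real)" using hh dr dr' by auto
    moreover have "d * of_int (r' - r) = h' - h" using dr dr' by (simp add: algebra_simps)
    ultimately have "d = (h' - h) / of_int (r' - r)" by (metis nonzero_eq_divide_eq)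
    hence "mu\<^sub>1 = (h' - h) / of_int (r' - r) + lam\<^sub>1" unfolding d_def by linarith
    moreover have "\<epsilon> = - (1 / lam\<^sub>0) * (h + lam\<^sub>1 * of_int r)" "\<epsilon>' = - (lam\<^sub>1 * of_int r' / lam\<^sub>0)"
      using assms(3,4,6) by (simp_all add: field_simps)
    moreover have "h / h' \<in> \<rat>" unfolding ratio by simp
    ultimately show "h / h' = of_int r / of_int r' \<and> h / h' \<in> \<rat> \<and>
        mu\<^sub>1 = (h' - h) / of_int (r' - r) + lam\<^sub>1 \<and>
        \<epsilon> = - (1 / lam\<^sub>0) * (h + lam\<^sub>1 * of_int r) \<and>
        \<epsilon>' = - (lam\<^sub>1 * of_int r' / lam\<^sub>0) \<and>
        \<beta> = 2 * of_real pi * \<i> * of_real lam\<^sub>0 * of_real ((h - h') / (h * h')) \<and>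
        \<gamma> = 2 * of_real pi * \<i> / of_int r'
            + 2 * of_real pi * \<i> * of_real lam\<^sub>1 * of_real ((h - h') / (h * h'))"
      using ratio beta gamma unfolding P_def by blast
  qed
qed

end
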